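(* For every positive integer $d$ there is an oriented regular map whose duality index is equal to $d$ and is not extreme.
   Context: An oriented regular hypermap is a triple $\mathcal{H}=(G,x,y)$ where $G$ is a group generated by the ordered pair $x,y$ (equivalently, $G=\Delta^+/H$ for a normal subgroup $H$ of the free group $\Delta^+$ of rank $2$, with $x,y$ the images of the two free generators). The group $G$ is the monodromy group $Mon(\mathcal{H})$. An oriented regular map is an oriented regular hypermap $(G,x,y)$ with $(xy)^2=1$. An oriented regular hypermap is self-dual if there is an automorphism of $G$ interchanging $x$ and $y$. The duality group $D(\mathcal{H})$ is the smallest normal subgroup $N\trianglelefteq G$ such that the assignment $x\mapsto y$, $y\mapsto x$ induces an automorphism of $G/N$ (equivalently, such that $\mathcal{H}/N=(G/N,xN,yN)$ is self-dual). The duality index of $\mathcal{H}$ is $|D(\mathcal{H})|$. The hypermap has extreme duality index if $D(\mathcal{H})=G$; otherwise its duality index is called non extreme. *)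

theory Defs
  imports "HOL-Algebra.Coset" "HOL-Algebra.Generated_Groups"
begin

definition oriented_regular_hypermap :: "('a, 'b) monoid_scheme \<Rightarrow> 'a \<Rightarrow> 'a \<Rightarrow> bool" where
  "oriented_regular_hypermap G x y \<longleftrightarrow>
     group G \<and> x \<in> carrier G \<and> y \<in> carrier G \<and> generate G {x, y} = carrier G"

definition oriented_regular_map :: "('a, 'b) monoid_scheme \<Rightarrow> 'a \<Rightarrow> 'a \<Rightarrow> bool" where
  "oriented_regular_map G x y \<longleftrightarrow>
     oriented_regular_hypermap G x y \<and> (x \<otimes>\<^bsub>G\<^esub> y) [^]\<^bsub>G\<^esub> (2::nat) = \<one>\<^bsub>G\<^esub>"

definition self_dual :: "('a, 'b) monoid_scheme \<Rightarrow> 'a \<Rightarrow> 'a \<Rightarrow> bool" where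
  "self_dual G x y \<longleftrightarrow> (\<exists>\<phi> \<in> iso G G. \<phi> x = y \<and> \<phi> y = x)"

definition self_dual_normal :: "('a, 'b) monoid_scheme \<Rightarrow> 'a \<Rightarrow> 'a \<Rightarrow> 'a set \<Rightarrow> bool" where
  "self_dual_normal G x y N \<longleftrightarrow>
     N \<lhd> G \<and> self_dual (G Mod N) (N #>\<^bsub>G\<^esub> x) (N #>\<^bsub>G\<^esub> y)"

(* LEAST is taken with respect to inclusion of sets; the smallest such subgroup
   always exists, see duality_group_least below. *)
definition duality_group :: "('a, 'b) monoid_scheme \<Rightarrow> 'a \<Rightarrow> 'a \<Rightarrow> 'a set" where
  "duality_group G x y = (LEAST N. self_dual_normal G x y N)"

(* A natural number: 0 stands for an infinite duality group. *)
definition duality_index :: "('a, 'b) monoid_scheme \<Rightarrow> 'a \<Rightarrow> 'a \<Rightarrow> nat" where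
  "duality_index G x y = card (duality_group G x y)"

definition extreme_duality_index :: "('a, 'b) monoid_scheme \<Rightarrow> 'a \<Rightarrow> 'a \<Rightarrow> bool" where
  "extreme_duality_index G x y \<longleftrightarrow> duality_group G x y = carrier G"

lemma (in group) rcos_eq_iff:
  assumes "N \<lhd> G" "a \<in> carrier G" "b \<in> carrier G"
  shows "N #> a = N #> b \<longleftrightarrow> a \<otimes> inv b \<in> N"
  using assms normal_imp_subgroup
  by (metis coset_join1 coset_join2 coset_mult_inv1 coset_mult_inv2 inv_closed m_closed subgroup.subset
      r_coset_subset_G)

lemma duality_group_least:
  fixes G (structure)
  assumes H: "oriented_regular_hypermap G x y"
  shows "self_dual_normal G x y (duality_group G x y)"
    and "self_dual_normal G x y N \<Longrightarrow> duality_group G x y \<subseteq> N"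
proof -
  interpret group G using H by (simp add: oriented_regular_hypermap_def)
  have x: "x \<in> carrier G" and y: "y \<in> carrier G" and gen: "generate G {x, y} = carrier G"
    using H by (auto simp: oriented_regular_hypermap_def)
  define S where "S = {N. self_dual_normal G x y N}"
  define D where "D = \<Inter>S"
  have normS: "N \<lhd> G" if "N \<in> S" for N using that by (simp add: S_def self_dual_normal_def)
  have subS: "subgroup N G" if "N \<in> S" for N using normS that normal_imp_subgroup by blast
  have GS: "carrier G \<in> S"
  proof -
    have n: "carrier G \<lhd> G" by (simp add: normal_inv_iff subgroup_self)
    have c: "carrier G #> g = carrier G" if "g \<in> carrier G" for g
      using that by (simp add: coset_join2 subgroup_self)
    have "id \<in> iso (G Mod carrier G) (G Mod carrier G)"
      by (auto simp: iso_def hom_def)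
    then show ?thesis using c x y n
      by (auto simp: S_def self_dual_normal_def self_dual_def intro!: bexI[of _ id])
  qed
  have Dsub: "subgroup D G"
    unfolding D_def using subgroups_Inter[of S] subS GS by blast
  have Dnorm: "D \<lhd> G"
    unfolding normal_inv_iff using Dsub normS normal.inv_op_closed2 by (fastforce simp: D_def)
  have Deq: "D #> a = D #> b \<longleftrightarrow> (\<forall>N\<in>S. N #> a = N #> b)"
    if "a \<in> carrier G" "b \<in> carrier G" for a b
    using that rcos_eq_iff Dnorm normS by (auto simp: D_def)
  have "\<forall>N\<in>S. \<exists>\<phi>. \<phi> \<in> iso (G Mod N) (G Mod N) \<and> \<phi> (N #> x) = N #> y \<and> \<phi> (N #> y) = N #> x"
    by (auto simp: S_def self_dual_normal_def self_dual_def)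
  then obtain \<phi> where \<phi>: "\<And>N. N \<in> S \<Longrightarrow> \<phi> N \<in> iso (G Mod N) (G Mod N)"
    and \<phi>xy: "\<And>N. N \<in> S \<Longrightarrow> \<phi> N (N #> x) = N #> y" "\<And>N. N \<in> S \<Longrightarrow> \<phi> N (N #> y) = N #> x"
    by metis
  have car: "N #> a \<in> carrier (G Mod N)" if "a \<in> carrier G" for N a
    using that by (auto simp: FactGroup_def RCOSETS_def)
  have mm: "(N #> a) \<otimes>\<^bsub>G Mod N\<^esub> (N #> b) = N #> (a \<otimes> b)"
    if "N \<lhd> G" "a \<in> carrier G" "b \<in> carrier G" for N a b
    using that by (simp add: FactGroup_def normal.rcos_sum)
  define R where "R g h \<longleftrightarrow> g \<in> carrier G \<and> h \<in> carrier G \<and> (\<forall>N\<in>S. \<phi> N (N #> g) = N #> h)" for g h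
  have Rone: "R \<one> \<one>"
  proof -
    have "\<phi> N (N #> \<one>) = N #> \<one>" if N: "N \<in> S" for N
    proof -
      have g: "group (G Mod N)" using normS[OF N] normal.factorgroup_is_group by blast
      have "\<one>\<^bsub>G Mod N\<^esub> = N #> \<one>" using coset_mult_one[OF subgroup.subset[OF subS[OF N]]]
        by (simp add: FactGroup_def)
      moreover have "\<phi> N \<one>\<^bsub>G Mod N\<^esub> = \<one>\<^bsub>G Mod N\<^esub>"
        using \<phi>[OF N] hom_one[OF _ g g, of "\<phi> N"] by (simp add: iso_def)
      ultimately show ?thesis by simp
    qed
    then show ?thesis by (simp add: R_def)
  qed
  have Rmul: "R (a \<otimes> b) (a' \<otimes> b')" if "R a a'" "R b b'" for a a' b b'
  proof -
    have "\<phi> N (N #> (a \<otimes> b)) = N #> (a' \<otimes> b')" if N: "N \<in> S" for N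
    proof -
      have "\<phi> N (N #> (a \<otimes> b)) = \<phi> N ((N #> a) \<otimes>\<^bsub>G Mod N\<^esub> (N #> b))"
        using mm[OF normS[OF N]] \<open>R a a'\<close> \<open>R b b'\<close> by (simp add: R_def)
      also have "\<dots> = \<phi> N (N #> a) \<otimes>\<^bsub>G Mod N\<^esub> \<phi> N (N #> b)"
        using \<phi>[OF N] car \<open>R a a'\<close> \<open>R b b'\<close> by (intro hom_mult) (auto simp: iso_def R_def)
      also have "\<dots> = N #> (a' \<otimes> b')"
        using mm[OF normS[OF N]] \<open>R a a'\<close> \<open>R b b'\<close> N by (simp add: R_def)
      finally show ?thesis .
    qed
    then show ?thesis using that by (auto simp: R_def)
  qed
  have Rinv: "R (inv a) (inv a')" if r: "R a a'" for a a'
  proof -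
    have ac: "a \<in> carrier G" "a' \<in> carrier G" using r by (auto simp: R_def)
    have "\<phi> N (N #> inv a) = N #> inv a'" if N: "N \<in> S" for N
    proof -
      have g: "group (G Mod N)" using normS[OF N] normal.factorgroup_is_group by blast
      have i: "inv\<^bsub>G Mod N\<^esub> (N #> b) = N #> inv b" if "b \<in> carrier G" for b
        using that normS[OF N] car[of b N] normal.inv_FactGroup[of N G] normal.rcos_inv[of N G b] by simp
      have gh: "group_hom (G Mod N) (G Mod N) (\<phi> N)"
        using \<phi>[OF N] g by (simp add: group_hom_def group_hom_axioms_def iso_def)
      show ?thesis
        using group_hom.hom_inv[OF gh car[OF ac(1)]] i ac r N by (simp add: R_def)
    qed
    then show ?thesis using ac by (simp add: R_def)
  qed
  have Rxy: "R x y" "R y x" using x y \<phi>xy by (auto simp: R_def)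
  have ind: "(\<exists>h. R g h) \<and> (\<exists>h. R h g)" if "g \<in> carrier G" for g
  proof -
    have "g \<in> generate G {x, y}" using that gen by simp
    then show ?thesis
    proof induction
      case one then show ?case using Rone by blast
    next
      case (incl h) then show ?case using Rxy by blast
    next
      case (inv h) then show ?case using Rxy Rinv by blast
    next
      case (eng h1 h2) then show ?case using Rmul by blast
    qed
  qed
  define f where "f g = (SOME h. R g h)" for g
  have f: "R g (f g)" if "g \<in> carrier G" for g
    unfolding f_def using ind[OF that] someI_ex by metis
  have funq: "D #> f g = D #> h" if "R g h" for g h
    using that f[of g] Deq by (simp add: R_def)
  define F where "F g = D #> f g" for g
  interpret Q: group "G Mod D" using Dnorm normal.factorgroup_is_group by blast
  have Fhom: "group_hom G (G Mod D) F"
  proof (unfold_locales, rule homI)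
    show "F a \<in> carrier (G Mod D)" if "a \<in> carrier G" for a
      using f[OF that] car by (simp add: F_def R_def)
    show "F (a \<otimes> b) = F a \<otimes>\<^bsub>G Mod D\<^esub> F b" if "a \<in> carrier G" "b \<in> carrier G" for a b
      using funq[OF Rmul[OF f[OF that(1)] f[OF that(2)]]] mm[OF Dnorm] f that
      by (simp add: F_def R_def)
  qed
  have oneD: "\<one>\<^bsub>G Mod D\<^esub> = D #> \<one>"
    using coset_mult_one[OF subgroup.subset[OF Dsub]] by (simp add: FactGroup_def)
  have ker: "kernel G (G Mod D) F = D"
  proof -
    have "F g = D #> \<one> \<longleftrightarrow> g \<in> D" if g: "g \<in> carrier G" for g
    proof -
      have "F g = D #> \<one> \<longleftrightarrow> (\<forall>N\<in>S. N #> f g = N #> \<one>)"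
        using f[OF g] Deq by (simp add: F_def R_def)
      also have "\<dots> \<longleftrightarrow> (\<forall>N\<in>S. \<phi> N (N #> g) = \<phi> N (N #> \<one>))"
        using f[OF g] Rone by (simp add: R_def)
      also have "\<dots> \<longleftrightarrow> (\<forall>N\<in>S. N #> g = N #> \<one>)"
        using \<phi> car g
        by (intro ball_cong refl inj_on_eq_iff[where A = "carrier (G Mod N)" for N])
          (auto simp: iso_def bij_betw_def)
      also have "\<dots> \<longleftrightarrow> D #> g = D #> \<one>" using Deq g by simp
      also have "\<dots> \<longleftrightarrow> g \<in> D" using rcos_eq_iff[OF Dnorm g] by (simp add: g)
      finally show ?thesis .
    qed
    then have "F g = \<one>\<^bsub>G Mod D\<^esub> \<longleftrightarrow> g \<in> D" if "g \<in> carrier G" for g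
      using that by (simp only: oneD)
    then show ?thesis using subgroup.subset[OF Dsub] by (auto simp only: kernel_def)
  qed
  have surj: "F ` carrier G = carrier (G Mod D)"
  proof
    show "F ` carrier G \<subseteq> carrier (G Mod D)"
      using group_hom.hom_closed[OF Fhom] by blast
    show "carrier (G Mod D) \<subseteq> F ` carrier G"
    proof
      fix C assume "C \<in> carrier (G Mod D)"
      then obtain h where h: "h \<in> carrier G" "C = D #> h" by (auto simp: FactGroup_def RCOSETS_def)
      then obtain g where "R g h" using ind by blast
      then show "C \<in> F ` carrier G" using funq h by (auto simp: F_def R_def)
    qed
  qed
  have iso: "(\<lambda>X. the_elem (F ` X)) \<in> iso (G Mod D) (G Mod D)"
    using group_hom.FactGroup_iso_set[OF Fhom surj] ker by simp
  have val: "the_elem (F ` (D #> a)) = D #> b" if "R a b" for a b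
  proof -
    have ac: "a \<in> carrier G" using that by (simp add: R_def)
    have "F u = F a" if u: "u \<in> D #> a" for u
    proof -
      obtain k where k: "k \<in> D" "u = k \<otimes> a" using u by (auto simp: r_coset_def)
      have kc: "k \<in> carrier G" "F k = \<one>\<^bsub>G Mod D\<^esub>" using k ker by (auto simp: kernel_def)
      show ?thesis
        using group_hom.hom_mult[OF Fhom kc(1) ac] Q.l_one[OF group_hom.hom_closed[OF Fhom ac]]
        by (simp only: k kc)
    qed
    moreover have "a \<in> D #> a" using ac Dsub rcos_self by blast
    ultimately have "F ` (D #> a) = {F a}" by blast
    then show ?thesis using funq[OF that] by (simp add: F_def)
  qed
  have DS: "self_dual_normal G x y D"
    unfolding self_dual_normal_def self_dual_def
    using Dnorm iso val Rxy by (auto intro!: bexI[of _ "\<lambda>X. the_elem (F ` X)"])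
  have low: "D \<subseteq> N" if "self_dual_normal G x y N" for N using that by (auto simp: D_def S_def)
  have "duality_group G x y = D"
    unfolding duality_group_def using DS low by (intro Least_equality)
  then show "self_dual_normal G x y (duality_group G x y)"
    and "self_dual_normal G x y N \<Longrightarrow> duality_group G x y \<subseteq> N" using DS low by auto
qed

end

theory Submission
  imports Defs "HOL-Combinatorics.Transposition"
begin

text \<open>
  The witness is the dihedral group of order \<open>4 * d\<close>, generated by a rotation \<open>x\<close> of order
  \<open>2 * d\<close> and a reflection \<open>y\<close>; since \<open>x \<otimes> y\<close> is again a reflection, this is a map.
  In every self-dual quotient \<open>x\<close> must satisfy the relation \<open>y\<^sup>2 = 1\<close> of \<open>y\<close>, so the kernel
  contains \<open>x\<^sup>2\<close> (lemma \<open>square_in_self_dual_normal\<close>) and hence the cyclic group of order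
  \<open>d\<close> that \<open>x\<^sup>2\<close> generates. Conversely that subgroup is normal, and its quotient is
  the Klein four-group on the images of \<open>x\<close> and \<open>y\<close>, in which these two can be interchanged
  (lemma \<open>self_dual_normalI\<close>). So the duality group has order \<open>d\<close>, a quarter of the order of the
  whole group. That the rotation has even order is essential: for odd order \<open>x\<close> is a power
  of \<open>x\<^sup>2\<close>, so every self-dual quotient is trivial and the duality index is extreme.

  The group is realised on the residues modulo \<open>4 * d\<close>, where \<open>2 * i + e\<close> stands for
  \<open>x\<^sup>i y\<^sup>e\<close>, so that \<open>x = 2\<close> and \<open>y = 1\<close>. Then \<open>y x y = x\<^sup>-\<^sup>1\<close> turns into the single formula \<open>a + (-1)\<^sup>a b\<close>
  for the product, and passing to the
  Klein four-group is reduction modulo \<open>4\<close>.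
\<close>

section \<open>Self-dual quotients\<close>

text \<open>A relation of one generator holds for the other one in every self-dual quotient, as the
  duality automorphism carries it over.\<close>

lemma square_in_self_dual_normal:
  fixes G (structure)
  assumes "group G" "x \<in> carrier G" "y \<in> carrier G" "y \<otimes> y = \<one>" "self_dual_normal G x y N"
  shows "x \<otimes> x \<in> N"
proof -
  interpret group G by fact
  from assms(5) obtain f where N: "N \<lhd> G" and f: "f \<in> iso (G Mod N) (G Mod N)"
    and fy: "f (N #> y) = N #> x"
    by (auto simp: self_dual_normal_def self_dual_def)
  interpret N: normal N G by fact
  interpret Q: group "G Mod N" by (rule N.factorgroup_is_group)
  have one: "\<one>\<^bsub>G Mod N\<^esub> = N" by (simp add: FactGroup_def)
  have car: "N #> y \<in> carrier (G Mod N)" using assms by (auto simp: FactGroup_def RCOSETS_def)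
  have sq: "(N #> a) \<otimes>\<^bsub>G Mod N\<^esub> (N #> a) = N #> (a \<otimes> a)" if "a \<in> carrier G" for a
    using that by (simp add: FactGroup_def N.rcos_sum)
  have h: "f \<in> hom (G Mod N) (G Mod N)" using f by (simp add: iso_def)
  have "N #> (x \<otimes> x) = f ((N #> y) \<otimes>\<^bsub>G Mod N\<^esub> (N #> y))"
    using hom_mult[OF h car car] fy sq assms(2) by simp
  also have "\<dots> = f \<one>\<^bsub>G Mod N\<^esub>"
    using sq assms(3,4) by (simp add: one coset_mult_one N.subset)
  also have "\<dots> = N" using hom_one[OF h Q.is_group Q.is_group] by (simp add: one)
  finally show ?thesis using assms(2) N.subgroup_axioms
    by (metis m_closed rcos_self)
qed

text \<open>An involution of the underlying set that permutes the cosets of \<open>N\<close> acts on the quotient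
  by taking images of cosets, and being its own inverse it is a bijection there; it only needs to
  be multiplicative modulo \<open>N\<close>, so it need not be an automorphism of \<open>G\<close>.\<close>

lemma self_dual_normalI:
  fixes G (structure)
  assumes "group G" "x \<in> carrier G" "y \<in> carrier G" "N \<lhd> G"
    and closed: "\<And>a. a \<in> carrier G \<Longrightarrow> s a \<in> carrier G"
    and invol: "\<And>a. a \<in> carrier G \<Longrightarrow> s (s a) = a"
    and coset: "\<And>a. a \<in> carrier G \<Longrightarrow> s ` (N #> a) = N #> s a"
    and mult: "\<And>a b. \<lbrakk>a \<in> carrier G; b \<in> carrier G\<rbrakk> \<Longrightarrow> N #> s (a \<otimes> b) = N #> (s a \<otimes> s b)"
    and "s x = y"
  shows "self_dual_normal G x y N"
proof -
  interpret group G by fact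
  interpret N: normal N G by fact
  have car: "carrier (G Mod N) = (\<lambda>a. N #> a) ` carrier G"
    by (auto simp: FactGroup_def RCOSETS_def)
  have m: "(N #> a) \<otimes>\<^bsub>G Mod N\<^esub> (N #> b) = N #> (a \<otimes> b)"
    if "a \<in> carrier G" "b \<in> carrier G" for a b
    using that by (simp add: FactGroup_def N.rcos_sum)
  have "image s \<in> hom (G Mod N) (G Mod N)"
  proof (rule homI)
    fix A B assume "A \<in> carrier (G Mod N)" "B \<in> carrier (G Mod N)"
    then obtain a b where "a \<in> carrier G" "A = N #> a" "b \<in> carrier G" "B = N #> b"
      by (auto simp: car)
    then show "s ` (A \<otimes>\<^bsub>G Mod N\<^esub> B) = s ` A \<otimes>\<^bsub>G Mod N\<^esub> s ` B"
      by (simp only: m coset closed mult m_closed)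
  qed (auto simp: car coset closed)
  moreover have "bij_betw (image s) (carrier (G Mod N)) (carrier (G Mod N))"
    by (rule bij_betw_byWitness[where f' = "image s"]) (auto simp: car coset closed invol)
  ultimately have "image s \<in> iso (G Mod N) (G Mod N)" by (simp add: iso_def)
  moreover have "s y = x" using assms by blast
  ultimately show ?thesis
    unfolding self_dual_normal_def self_dual_def
    using assms(2-4,9) coset by (intro conjI bexI[of _ "image s"]) simp_all
qed

section \<open>The dihedral group of order \<open>4 * d\<close> on residues\<close>

text \<open>The product of \<open>a = 2 * i + e\<close> and \<open>b\<close> is taken in the integers, where \<open>a\<close> is a
  reflection, and so inverts the rotation to its right, exactly if it is odd.\<close>

definition dih_mult :: "nat \<Rightarrow> nat \<Rightarrow> nat \<Rightarrow> nat" where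
  "dih_mult d a b = nat ((int a + (- 1) ^ a * int b) mod (4 * int d))"

definition dihedral :: "nat \<Rightarrow> nat monoid" where
  "dihedral d = \<lparr>carrier = {..<4 * d}, mult = dih_mult d, one = 0\<rparr>"

lemma dihedral_simps [simp]:
  "carrier (dihedral d) = {..<4 * d}"
  "a \<otimes>\<^bsub>dihedral d\<^esub> b = dih_mult d a b"
  "\<one>\<^bsub>dihedral d\<^esub> = 0"
  by (simp_all add: dihedral_def)

lemma int_dih_mult:
  "d > 0 \<Longrightarrow> int (dih_mult d a b) = (int a + (- 1) ^ a * int b) mod (4 * int d)"
  by (simp add: dih_mult_def)

lemma dih_mult_less: "d > 0 \<Longrightarrow> dih_mult d a b < 4 * d"
  using int_dih_mult[of d a b] pos_mod_bound[of "4 * int d" "int a + (- 1) ^ a * int b"] by linarith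

lemma dih_mult_mod_4:
  assumes "d > 0"
  shows "int (dih_mult d a b mod 4) = (int a + (- 1) ^ a * int b) mod 4"
  using assms by (simp add: zmod_int int_dih_mult mod_mod_cancel)

lemma even_dih_mult: "d > 0 \<Longrightarrow> even (dih_mult d a b) \<longleftrightarrow> (even a \<longleftrightarrow> even b)"
proof -
  assume "d > 0"
  have "even (int (dih_mult d a b)) \<longleftrightarrow> even (int a + (- 1) ^ a * int b)"
    using \<open>d > 0\<close> by (simp add: int_dih_mult dvd_mod_iff)
  then show ?thesis by simp
qed

lemma neg_one_power_dih_mult:
  "d > 0 \<Longrightarrow> (- 1 :: int) ^ dih_mult d a b = (- 1) ^ a * (- 1) ^ b"
  using even_dih_mult[of d a b] by (cases "even a"; cases "even b") auto

lemma dih_mult_assoc: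
  assumes "d > 0"
  shows "dih_mult d (dih_mult d a b) c = dih_mult d a (dih_mult d b c)"
proof -
  let ?n = "4 * int d"
  have "int (dih_mult d (dih_mult d a b) c)
      = (int a + (- 1) ^ a * int b + (- 1) ^ a * (- 1) ^ b * int c) mod ?n"
    using assms by (simp add: int_dih_mult neg_one_power_dih_mult mod_add_left_eq)
  also have "\<dots> = (int a + (- 1) ^ a * (int b + (- 1) ^ b * int c)) mod ?n"
    by (simp add: algebra_simps)
  also have "\<dots> = int (dih_mult d a (dih_mult d b c))"
    using assms unfolding int_dih_mult[OF assms] by (metis mod_add_right_eq mod_mult_right_eq)
  finally show ?thesis by simp
qed

lemma dih_mult_even:
  assumes "even a" "a + b < 4 * d"
  shows "dih_mult d a b = a + b"
  using assms by (simp add: dih_mult_def flip: of_nat_add)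

lemma dih_mult_self_odd: "odd a \<Longrightarrow> dih_mult d a a = 0"
  by (simp add: dih_mult_def)

lemma group_dihedral:
  assumes "d > 0"
  shows "group (dihedral d)"
proof (rule groupI)
  fix a assume "a \<in> carrier (dihedral d)"
  then have a: "a < 4 * d" by simp
  show "\<exists>b\<in>carrier (dihedral d). b \<otimes>\<^bsub>dihedral d\<^esub> a = \<one>\<^bsub>dihedral d\<^esub>"
  proof (cases "even a")
    case True
    have "dih_mult d ((4 * d - a) mod (4 * d)) a = 0"
    proof (cases "a = 0")
      case False
      then show ?thesis using True a by (simp add: dih_mult_def of_nat_diff)
    qed (simp add: dih_mult_def)
    then show ?thesis using assms by (intro bexI[of _ "(4 * d - a) mod (4 * d)"]) auto
  next
    case False
    then show ?thesis using a by (intro bexI[of _ a]) (auto simp: dih_mult_self_odd)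
  qed
qed (use assms in \<open>auto simp: dih_mult_less dih_mult_assoc dih_mult_even\<close>)

lemma oriented_regular_map_dihedral:
  assumes "d > 0"
  shows "oriented_regular_map (dihedral d) 2 1"
proof -
  interpret group "dihedral d" using assms by (rule group_dihedral)
  have in_gen: "a < 4 * d \<longrightarrow> a \<in> generate (dihedral d) {2, 1}" for a
  proof (induction a rule: less_induct)
    case (less a)
    consider "a = 0" | "a = 1" | b where "a = 2 + b"
      by (metis One_nat_def add_2_eq_Suc less_2_cases_iff less_iff_Suc_add not_less_eq not_gr0)
    then show ?case
    proof cases
      case 1
      then show ?thesis using generate.one[of "dihedral d"] by simp
    next
      case 2
      then show ?thesis by (simp add: generate.incl)
    next
      case 3
      have "2 \<in> generate (dihedral d) {2, 1}" by (simp add: generate.incl)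
      then show ?thesis
        using less 3 generate.eng[of 2 "dihedral d" "{2, 1}" b] by (auto simp: dih_mult_even)
    qed
  qed
  have "{2, 1} \<subseteq> carrier (dihedral d)" using assms by auto
  then have "generate (dihedral d) {2, 1} = carrier (dihedral d)"
    using in_gen generate_incl[of "{2, 1}"] by (intro equalityI) auto
  moreover have "dih_mult d 2 1 = 3" "dih_mult d 3 3 = 0" "dih_mult d 0 3 = 3" using assms
    by (simp_all add: dih_mult_even dih_mult_self_odd)
  ultimately show ?thesis
    using assms is_group nat_pow_Suc[of 3 1] nat_pow_Suc[of 3 0]
    by (simp add: oriented_regular_map_def oriented_regular_hypermap_def flip: numeral_2_eq_2)
qed

section \<open>The duality group\<close>

text \<open>This is the subgroup generated by \<open>x\<^sup>2\<close>: the number \<open>4 * k\<close> encodes \<open>x\<^sup>2\<^sup>k\<close>.\<close>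

definition rot_squares :: "nat \<Rightarrow> nat set" where
  "rot_squares d = {a. a < 4 * d \<and> a mod 4 = 0}"

lemma card_rot_squares: "card (rot_squares d) = d"
proof -
  have "rot_squares d = (\<lambda>k. 4 * k) ` {..<d}"
    by (auto simp: rot_squares_def image_iff elim!: dvdE)
  then show ?thesis by (simp add: card_image inj_on_def)
qed

text \<open>The sign in the product depends on the parity of the left factor only, and \<open>4\<close> divides the
  modulus, so multiplication descends to residues modulo \<open>4\<close>. This is why the multiples of
  \<open>4\<close> are normal and why their cosets are the residue classes.\<close>

lemma dih_mult_mod_4_cong:
  assumes "d > 0" "a mod 4 = a' mod 4" "b mod 4 = b' mod 4"
  shows "dih_mult d a b mod 4 = dih_mult d a' b' mod 4"
proof -
  have "even a \<longleftrightarrow> even a'" using assms(2) by presburger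
  then have "(- 1 :: int) ^ a = (- 1) ^ a'" by (cases "even a") auto
  moreover have "int a mod 4 = int a' mod 4" "int b mod 4 = int b' mod 4"
    using assms by (metis of_nat_mod of_nat_numeral)+
  ultimately have "int (dih_mult d a b mod 4) = int (dih_mult d a' b' mod 4)"
    using assms(1) by (simp only: dih_mult_mod_4) (metis mod_add_cong mod_mult_cong)
  then show ?thesis by (simp only: of_nat_eq_iff)
qed

lemma normal_rot_squares:
  assumes "d > 0"
  shows "rot_squares d \<lhd> dihedral d"
proof -
  interpret group "dihedral d" using assms by (rule group_dihedral)
  have zero: "dih_mult d a b mod 4 = 0" if "a mod 4 = 0" "b mod 4 = 0" for a b
    using that dih_mult_mod_4_cong[OF assms, of a 0 b 0] by (simp add: dih_mult_def)
  have conj: "dih_mult d (dih_mult d g a) (inv\<^bsub>dihedral d\<^esub> g) mod 4 = 0"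
    if g: "g < 4 * d" and a: "a mod 4 = 0" for g a
  proof -
    have "dih_mult d g a mod 4 = g mod 4"
      using dih_mult_mod_4_cong[OF assms, of g g a 0] r_one[of g] a g by simp
    then have "dih_mult d (dih_mult d g a) (inv\<^bsub>dihedral d\<^esub> g) mod 4
        = dih_mult d g (inv\<^bsub>dihedral d\<^esub> g) mod 4"
      by (rule dih_mult_mod_4_cong[OF assms _ refl])
    then show ?thesis using r_inv[of g] g by simp
  qed
  have invc: "inv\<^bsub>dihedral d\<^esub> a < 4 * d" if "a < 4 * d" for a
    using inv_closed[of a] that by simp
  have "subgroup (rot_squares d) (dihedral d)"
  proof (rule subgroupI)
    fix a assume "a \<in> rot_squares d"
    then have a: "a < 4 * d" "a mod 4 = 0" by (auto simp: rot_squares_def)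
    have "inv\<^bsub>dihedral d\<^esub> a mod 4 = dih_mult d a (inv\<^bsub>dihedral d\<^esub> a) mod 4"
      using dih_mult_mod_4_cong[OF assms, of a 0 "inv\<^bsub>dihedral d\<^esub> a" "inv\<^bsub>dihedral d\<^esub> a"]
        a invc[OF a(1)] by (simp add: dih_mult_even)
    then show "inv\<^bsub>dihedral d\<^esub> a \<in> rot_squares d"
      using r_inv[of a] a invc by (simp add: rot_squares_def)
  qed (use assms in \<open>auto simp: rot_squares_def dih_mult_less zero intro: exI[of _ 0]\<close>)
  then show ?thesis
    using conj assms by (auto simp: normal_inv_iff rot_squares_def dih_mult_less)
qed

lemma rot_squares_coset:
  assumes "d > 0" "a < 4 * d"
  shows "rot_squares d #>\<^bsub>dihedral d\<^esub> a = {c. c < 4 * d \<and> c mod 4 = a mod 4}"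
proof (rule Set.set_eqI, rule iffI)
  fix c assume "c \<in> rot_squares d #>\<^bsub>dihedral d\<^esub> a"
  then obtain k where k: "k mod 4 = 0" "c = dih_mult d k a"
    unfolding r_coset_def rot_squares_def by force
  then show "c \<in> {c. c < 4 * d \<and> c mod 4 = a mod 4}"
    using dih_mult_mod_4_cong[OF assms(1), of k 0 a a] assms
    by (simp add: dih_mult_less dih_mult_even)
next
  interpret group "dihedral d" using assms(1) by (rule group_dihedral)
  fix c assume "c \<in> {c. c < 4 * d \<and> c mod 4 = a mod 4}"
  then have c: "c < 4 * d" "c mod 4 = a mod 4" by auto
  have "dih_mult d c (inv\<^bsub>dihedral d\<^esub> a) mod 4 = dih_mult d a (inv\<^bsub>dihedral d\<^esub> a) mod 4"
    by (rule dih_mult_mod_4_cong[OF assms(1) c(2) refl])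
  then have "dih_mult d c (inv\<^bsub>dihedral d\<^esub> a) \<in> rot_squares d"
    using r_inv[of a] assms by (simp add: rot_squares_def dih_mult_less)
  moreover have "dih_mult d (dih_mult d c (inv\<^bsub>dihedral d\<^esub> a)) a = c"
    using inv_solve_right'[of c "dih_mult d c (inv\<^bsub>dihedral d\<^esub> a)" a]
      m_assoc[of c "inv\<^bsub>dihedral d\<^esub> a" a] l_inv[of a] r_one[of c] inv_closed[of a] assms c by simp
  ultimately show "c \<in> rot_squares d #>\<^bsub>dihedral d\<^esub> a"
    by (force simp: r_coset_def)
qed

text \<open>The residues \<open>2\<close> and \<open>1\<close> modulo \<open>4\<close> are the images of \<open>x\<close> and \<open>y\<close>. Keeping
  \<open>a div 4\<close> makes the interchange an involution of the carrier, as lemma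
  \<open>self_dual_normalI\<close> demands; for \<open>d > 1\<close> it is not an automorphism of the dihedral group.\<close>

definition swap_12_mod_4 :: "nat \<Rightarrow> nat" where
  "swap_12_mod_4 a = 4 * (a div 4) + transpose 1 2 (a mod 4)"

lemma transpose_12_less_4: "transpose 1 2 (a mod 4) < (4::nat)"
  by (simp add: transpose_def)

lemma swap_12_mod_4_mod: "swap_12_mod_4 a mod 4 = transpose 1 2 (a mod 4)"
  using mod_less[OF transpose_12_less_4[of a]] by (simp only: swap_12_mod_4_def mod_mult_self4)

lemma swap_12_mod_4_div: "swap_12_mod_4 a div 4 = a div 4"
  using div_less[OF transpose_12_less_4[of a]] by (simp add: swap_12_mod_4_def)

lemma swap_12_mod_4_less: "a < 4 * d \<Longrightarrow> swap_12_mod_4 a < 4 * d"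
  by (metis div_less_iff_less_mult mult.commute swap_12_mod_4_div zero_less_numeral)

lemma swap_12_mod_4_invol: "swap_12_mod_4 (swap_12_mod_4 a) = a"
  by (simp only: swap_12_mod_4_def[of "swap_12_mod_4 a"] swap_12_mod_4_div swap_12_mod_4_mod
      transpose_involutory mult_div_mod_eq)

lemma swap_12_mod_4_cong:
  "swap_12_mod_4 a mod 4 = swap_12_mod_4 b mod 4 \<longleftrightarrow> a mod 4 = b mod 4"
  by (metis swap_12_mod_4_mod transpose_involutory)

lemma swap_12_mod_4_mult:
  assumes "d > 0"
  shows "swap_12_mod_4 (dih_mult d a b) mod 4
    = dih_mult d (swap_12_mod_4 a) (swap_12_mod_4 b) mod 4"
proof -
  \<comment> \<open>Modulo \<open>4\<close> the sign \<open>-1\<close> is \<open>3\<close>, so the Klein four-group has a product on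
    natural numbers, for which the interchange can be checked on all sixteen pairs of residues.\<close>
  define m :: "nat \<Rightarrow> nat \<Rightarrow> nat"
    where "m i j = (if even i then i + j else i + 3 * j) mod 4" for i j
  have four: "i mod 4 = 0 \<or> i mod 4 = 1 \<or> i mod 4 = 2 \<or> i mod 4 = 3" for i :: nat
    by presburger
  have small: "dih_mult d (i mod 4) (j mod 4) mod 4 = m (i mod 4) (j mod 4)" for i j
  proof -
    have "int (dih_mult d (i mod 4) (j mod 4) mod 4) = int (m (i mod 4) (j mod 4))"
      using four[of i] four[of j] assms by (elim disjE)
        (simp_all only: dih_mult_mod_4, simp_all add: m_def)
    then show ?thesis by (simp only: of_nat_eq_iff)
  qed
  have m: "dih_mult d i j mod 4 = m (i mod 4) (j mod 4)" for i j
    using dih_mult_mod_4_cong[OF assms, of i "i mod 4" j "j mod 4"] small by simp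
  have "transpose 1 2 (m (a mod 4) (b mod 4))
      = m (transpose 1 2 (a mod 4)) (transpose 1 2 (b mod 4))"
    using four[of a] four[of b] by (elim disjE) (simp_all add: m_def transpose_def)
  then show ?thesis by (simp only: swap_12_mod_4_mod m)
qed

lemma duality_group_dihedral:
  assumes "d > 0"
  shows "duality_group (dihedral d) 2 1 = rot_squares d"
proof
  have grp: "group (dihedral d)" using assms by (rule group_dihedral)
  have hyper: "oriented_regular_hypermap (dihedral d) 2 1"
    using oriented_regular_map_dihedral[OF assms] by (simp add: oriented_regular_map_def)
  have "self_dual_normal (dihedral d) 2 1 (rot_squares d)"
  proof (rule self_dual_normalI[where s = swap_12_mod_4])
    fix a assume "a \<in> carrier (dihedral d)"
    then have a: "a < 4 * d" by simp
    have "swap_12_mod_4 ` {c. c < 4 * d \<and> c mod 4 = a mod 4}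
        = {c. c < 4 * d \<and> c mod 4 = swap_12_mod_4 a mod 4}"
    proof (intro equalityI subsetI)
      fix c assume "c \<in> {c. c < 4 * d \<and> c mod 4 = swap_12_mod_4 a mod 4}"
      then show "c \<in> swap_12_mod_4 ` {c. c < 4 * d \<and> c mod 4 = a mod 4}"
        using swap_12_mod_4_less[of c d] swap_12_mod_4_cong[of c "swap_12_mod_4 a"]
        by (intro image_eqI[where x = "swap_12_mod_4 c"]) (simp_all add: swap_12_mod_4_invol)
    qed (auto simp: swap_12_mod_4_less swap_12_mod_4_cong)
    then show "swap_12_mod_4 ` (rot_squares d #>\<^bsub>dihedral d\<^esub> a)
        = rot_squares d #>\<^bsub>dihedral d\<^esub> swap_12_mod_4 a"
      using assms a by (simp add: rot_squares_coset swap_12_mod_4_less)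
  qed (use assms grp in \<open>auto simp: normal_rot_squares swap_12_mod_4_less swap_12_mod_4_invol
      rot_squares_coset dih_mult_less swap_12_mod_4_mult\<close>, simp add: swap_12_mod_4_def)
  then show "duality_group (dihedral d) 2 1 \<subseteq> rot_squares d"
    by (rule duality_group_least(2)[OF hyper])
  let ?D = "duality_group (dihedral d) 2 1"
  have sd: "self_dual_normal (dihedral d) 2 1 ?D"
    by (rule duality_group_least(1)[OF hyper])
  then have sub: "subgroup ?D (dihedral d)"
    by (simp add: self_dual_normal_def normal_imp_subgroup)
  have sq: "dih_mult d 2 2 \<in> ?D"
    using square_in_self_dual_normal[OF grp _ _ _ sd] assms by (simp add: dih_mult_self_odd)
  have "4 * k < 4 * d \<longrightarrow> 4 * k \<in> ?D" for k
  proof (induction k)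
    case 0
    then show ?case using subgroup.one_closed[OF sub] by simp
  next
    case (Suc k)
    show ?case
    proof
      assume less: "4 * Suc k < 4 * d"
      then have "4 \<in> ?D" "4 * k \<in> ?D" using sq Suc by (simp_all add: dih_mult_even)
      then show "4 * Suc k \<in> ?D"
        using subgroup.m_closed[OF sub, of 4 "4 * k"] less by (simp add: dih_mult_even)
    qed
  qed
  then show "rot_squares d \<subseteq> ?D" by (auto simp: rot_squares_def elim!: dvdE)
qed

theorem theorem5p3:
  fixes d :: nat
  assumes "d > 0"
  shows "\<exists>(G :: nat monoid) x y.
           oriented_regular_map G x y \<and>
           duality_index G x y = d \<and>
           \<not> extreme_duality_index G x y"
proof (intro exI conjI)
  show "oriented_regular_map (dihedral d) 2 1"
    using assms by (rule oriented_regular_map_dihedral)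
  show "duality_index (dihedral d) 2 1 = d"
    by (simp only: duality_index_def duality_group_dihedral[OF assms] card_rot_squares)
  have "1 \<in> carrier (dihedral d)" "1 \<notin> rot_squares d"
    using assms by (auto simp: rot_squares_def)
  then show "\<not> extreme_duality_index (dihedral d) 2 1"
    using assms by (metis extreme_duality_index_def duality_group_dihedral)
qed

end
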